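(* Let $S$ be a subring of a finite ring $R$ and let $r\in K(S,R)$ with $r\neq 0$. If $p$ is the smallest prime dividing $|R|$, then $$\mathrm{Pr}_r(S,R)\leq \frac{|S|-|Z(S,R)|}{p|S|} < \frac{1}{p}.$$
   Context: For elements $x,y$ of a ring $R$, $[x,y]=xy-yx$. For a subring $S$ of a finite ring $R$ and $r\in R$, $$\mathrm{Pr}_r(S,R)=\frac{|\{(x,y)\in S\times R : [x,y]=r\}|}{|S||R|}.$$ $K(S,R)=\{[x,y] : x\in S,\ y\in R\}$ and $Z(S,R)=\{x\in S : xy=yx \text{ for all } y\in R\}$. *)

theory Defs
  imports Complex_Main "HOL-Computational_Algebra.Primes"
begin

text \<open>
  Rings are associative and need not have a unit, which is the meaning of the type class
  \<^class>\<open>ring\<close>; accordingly a subring need not contain a unit. A ring \<open>R\<close> is given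
  by its carrier, a subring of the type \<open>'a\<close>, where \<open>R = UNIV\<close> is allowed.
\<close>

definition subring :: "'a::ring set \<Rightarrow> 'a set \<Rightarrow> bool" where
  "subring S R \<longleftrightarrow> S \<subseteq> R \<and> 0 \<in> S \<and> (\<forall>x\<in>S. \<forall>y\<in>S. x - y \<in> S \<and> x * y \<in> S)"

definition commutator :: "'a::ring \<Rightarrow> 'a \<Rightarrow> 'a" where
  "commutator x y = x * y - y * x"

definition commutators :: "'a::ring set \<Rightarrow> 'a set \<Rightarrow> 'a set" where
  "commutators S R = {commutator x y | x y. x \<in> S \<and> y \<in> R}"

definition relative_center :: "'a::ring set \<Rightarrow> 'a set \<Rightarrow> 'a set" where
  "relative_center S R = {x \<in> S. \<forall>y\<in>R. x * y = y * x}"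

definition Pr :: "'a::ring \<Rightarrow> 'a set \<Rightarrow> 'a set \<Rightarrow> real" where
  "Pr r S R = real (card {(x, y) \<in> S \<times> R. commutator x y = r}) / (real (card S) * real (card R))"

end

theory Submission imports Defs begin

text \<open>
  Counting pairs by their first component \<open>x\<close>, one has to bound the number of \<open>y \<in> R\<close> with
  \<open>[x,y] = r\<close>. The map \<open>y \<mapsto> [x,y]\<close> is additive, so its nonempty fibres on \<open>R\<close> all have the same
  size, and that size times the size of the image is \<open>|R|\<close> (\<open>card_fibre_times_card_image\<close>).
  If \<open>x\<close> does not centralise \<open>R\<close>, the image is a set of more than one element whose size divides
  \<open>|R|\<close>, so it has at least \<open>p\<close> elements and a fibre has at most \<open>|R| / p\<close>
  (\<open>card_additive_fibre_le\<close>). If \<open>x\<close> centralises \<open>R\<close>, the only value is \<open>0 \<noteq> r\<close> and the fibre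
  is empty. Summation over \<open>x \<in> S\<close> gives the first inequality; the second one is strict because
  \<open>0\<close> always lies in the relative centre.
\<close>

text \<open>
  This is the first isomorphism theorem together with Lagrange's theorem at the level of
  cardinalities: translation by the difference of two chosen preimages is a bijection between
  any two nonempty fibres.
\<close>

lemma card_fibre_times_card_image:
  fixes G :: "'a::ab_group_add set" and f :: "'a \<Rightarrow> 'b::ab_group_add"
  assumes "finite G"
    and diff: "\<And>x y. x \<in> G \<Longrightarrow> y \<in> G \<Longrightarrow> x - y \<in> G"
    and f_diff: "\<And>x y. f (x - y) = f x - f y"
    and "v \<in> f ` G"
  shows "card {y \<in> G. f y = v} * card (f ` G) = card G"
proof -
  have le: "card {y \<in> G. f y = u} \<le> card {y \<in> G. f y = w}"
    if u: "u \<in> f ` G" and w: "w \<in> f ` G" for u w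
  proof -
    obtain a b where ab: "a \<in> G" "f a = u" "b \<in> G" "f b = w"
      using u w by blast
    have "(\<lambda>y. y - (a - b)) ` {y \<in> G. f y = u} \<subseteq> {y \<in> G. f y = w}"
      using ab by (auto simp: f_diff intro!: diff)
    moreover have "inj_on (\<lambda>y. y - (a - b)) {y \<in> G. f y = u}"
      by (auto intro: inj_onI)
    ultimately show ?thesis
      using \<open>finite G\<close> by (intro card_inj_on_le) auto
  qed
  have "card G = (\<Sum>u \<in> f ` G. card {y \<in> G. f y = u})"
    using sum.image_gen[OF \<open>finite G\<close>, of "\<lambda>_. 1::nat" f] by simp
  also have "\<dots> = (\<Sum>u \<in> f ` G. card {y \<in> G. f y = v})"
    using le \<open>v \<in> f ` G\<close> by (intro sum.cong refl antisym) auto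
  finally show ?thesis by simp
qed

text \<open>
  The image of a nonzero additive map has a prime factor in its cardinality, and that prime
  also divides \<open>|G|\<close>; hence the image has at least \<open>p\<close> elements. Bounding an arbitrary fibre,
  possibly empty, spares the count below a case distinction on whether \<open>r\<close> is attained.
\<close>

lemma card_additive_fibre_le:
  fixes G :: "'a::ab_group_add set" and f :: "'a \<Rightarrow> 'b::ab_group_add"
  assumes "finite G" and "0 \<in> G"
    and diff: "\<And>x y. x \<in> G \<Longrightarrow> y \<in> G \<Longrightarrow> x - y \<in> G"
    and f_diff: "\<And>x y. f (x - y) = f x - f y"
    and nonzero: "a \<in> G" "f a \<noteq> 0"
    and least: "\<And>q::nat. prime q \<Longrightarrow> q dvd card G \<Longrightarrow> p \<le> q"
  shows "p * card {y \<in> G. f y = v} \<le> card G"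
proof (cases "v \<in> f ` G")
  case True
  have eq: "card {y \<in> G. f y = v} * card (f ` G) = card G"
    using \<open>finite G\<close> diff f_diff True by (rule card_fibre_times_card_image)
  have "f 0 = 0"
    using f_diff[of 0 0] by simp
  then have "{0, f a} \<subseteq> f ` G"
    using \<open>0 \<in> G\<close> \<open>a \<in> G\<close> by (metis empty_subsetI image_eqI insert_subset)
  then have "card {0, f a} \<le> card (f ` G)"
    using \<open>finite G\<close> by (intro card_mono) auto
  with nonzero have ge2: "2 \<le> card (f ` G)"
    by simp
  then have "card (f ` G) \<noteq> 1"
    by simp
  then obtain q where q: "prime q" "q dvd card (f ` G)"
    using prime_factor_nat by blast
  have "q dvd card G"
    using q(2) eq by (metis dvd_mult)
  then have "p \<le> q"
    using q(1) by (intro least)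
  also have "q \<le> card (f ` G)"
    using q(2) ge2 by (intro dvd_imp_le) auto
  finally show ?thesis
    using eq by (metis mult.commute mult_le_mono1)
next
  case False
  then have "{y \<in> G. f y = v} = {}"
    by blast
  then show ?thesis
    by (simp only: card.empty)
qed

lemma commutator_diff_right: "commutator x (y - z) = commutator x y - commutator x z"
  by (simp add: commutator_def algebra_simps)

theorem proposition3p1:
  fixes R S :: "'a::ring set" and r :: 'a and p :: nat
  assumes "subring R UNIV" and "finite R"
    and "subring S R"
    and "r \<in> commutators S R" and "r \<noteq> 0"
    and "prime p" and "p dvd card R"
    and "\<And>q::nat. prime q \<Longrightarrow> q dvd card R \<Longrightarrow> p \<le> q"
  shows "Pr r S R \<le> (real (card S) - real (card (relative_center S R))) / (real p * real (card S)) \<and>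
         (real (card S) - real (card (relative_center S R))) / (real p * real (card S)) < 1 / real p"
proof -
  define Z where "Z = relative_center S R"
  define T where "T x = {y \<in> R. commutator x y = r}" for x
  have R: "0 \<in> R" "\<And>x y. x \<in> R \<Longrightarrow> y \<in> R \<Longrightarrow> x - y \<in> R"
    using \<open>subring R UNIV\<close> by (auto simp: subring_def)
  have S: "S \<subseteq> R" "0 \<in> S"
    using \<open>subring S R\<close> by (auto simp: subring_def)
  have "finite S"
    using S(1) \<open>finite R\<close> by (rule finite_subset)
  have Z: "Z \<subseteq> S" "0 \<in> Z"
    using S(2) by (auto simp: Z_def relative_center_def)
  have "finite Z"
    using Z(1) \<open>finite S\<close> by (rule finite_subset)
  have pos: "0 < card R" "0 < card S" "0 < card Z" "0 < p"
    using \<open>finite R\<close> \<open>finite S\<close> \<open>finite Z\<close> R(1) S(2) Z(2) prime_gt_0_nat[OF \<open>prime p\<close>]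
    by (auto simp: card_gt_0_iff)
  have central: "T x = {}" if "x \<in> Z" for x
    using that \<open>r \<noteq> 0\<close> by (auto simp: T_def Z_def relative_center_def commutator_def)
  have noncentral: "p * card (T x) \<le> card R" if x: "x \<in> S - Z" for x
  proof -
    obtain y where "y \<in> R" "commutator x y \<noteq> 0"
      using x by (auto simp: Z_def relative_center_def commutator_def)
    then show ?thesis
      unfolding T_def
      using \<open>finite R\<close> R assms(8)
      by (intro card_additive_fibre_le[where a = y]) (auto simp: commutator_diff_right)
  qed
  have "{(x, y) \<in> S \<times> R. commutator x y = r} = Sigma S T"
    by (auto simp: T_def)
  then have "card {(x, y) \<in> S \<times> R. commutator x y = r} = (\<Sum>x\<in>S. card (T x))"
    using \<open>finite S\<close> \<open>finite R\<close> by (simp add: T_def)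
  also have "\<dots> = (\<Sum>x\<in>S - Z. card (T x))"
    using \<open>finite S\<close> by (intro sum.mono_neutral_right) (auto simp: central)
  finally have "p * card {(x, y) \<in> S \<times> R. commutator x y = r} = (\<Sum>x\<in>S - Z. p * card (T x))"
    by (simp add: sum_distrib_left)
  also have "\<dots> \<le> card (S - Z) * card R"
    using sum_bounded_above[of "S - Z" "\<lambda>x. p * card (T x)" "card R"] noncentral by simp
  finally have "real p * real (card {(x, y) \<in> S \<times> R. commutator x y = r})
      \<le> real (card (S - Z)) * real (card R)"
    by (simp only: of_nat_mult[symmetric] of_nat_le_iff)
  moreover have "real (card (S - Z)) = real (card S) - real (card Z)"
    using Z(1) \<open>finite S\<close> \<open>finite Z\<close> by (simp add: card_Diff_subset card_mono of_nat_diff)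
  ultimately have count: "real p * real (card {(x, y) \<in> S \<times> R. commutator x y = r})
      \<le> (real (card S) - real (card Z)) * real (card R)"
    by simp
  have "Pr r S R = real p * real (card {(x, y) \<in> S \<times> R. commutator x y = r})
      / (real p * real (card S) * real (card R))"
    using pos by (simp add: Pr_def)
  also have "\<dots> \<le> (real (card S) - real (card Z)) * real (card R)
      / (real p * real (card S) * real (card R))"
    using count by (rule divide_right_mono) simp
  also have "\<dots> = (real (card S) - real (card Z)) / (real p * real (card S))"
    using pos by simp
  finally have "Pr r S R \<le> (real (card S) - real (card Z)) / (real p * real (card S))" .
  moreover have "(real (card S) - real (card Z)) / (real p * real (card S)) < 1 / real p"
    using pos by (simp add: divide_simps)
  ultimately show ?thesis
    by (simp add: Z_def)
qed

end
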